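(* Fix a real $N>1$ and define $$\mathbf{1}_N:=\log_N N,\qquad \boldsymbol{-1}_N:=\log_N\!\left(\log_{N^N}N\right).$$ Then $\mathbf{1}_N=1$, $\boldsymbol{-1}_N=-1$, and, for real $x,y$ (with $x\ne0$ wherever $x^{-1}$ occurs and $y\neq0$ wherever $y^{-1}$ or $x/y$ occurs), $$xy=\log_N\!\left((N^x)^y\right),$$ $$x+y=\log_N\!\left(\log_N\!\left((N^{N^x})^{N^y}\right)\right),$$ $$x^{-1}=x^{\boldsymbol{-1}_N},\qquad x/y=\log_N\!\left((N^x)^{y^{\boldsymbol{-1}_N}}\right).$$ Together with the identity $J(u)=u-\frac12+\frac12\log_{-1}\!\left((-1)^{1-2u}\right)$ (for real $u$), these identities compile every source formula (listed in the context, with its domain) into a term over the two operations $\{x^y,\log_b a\}$: replacing the arithmetic operations and rational constants accordingly yields a term whose leaves are the input variables and $N$, and which is defined and equal to the source formula on the formula's domain. For the tag-system terms $F_T$ and $F_{T,m}$, no constants are required: substitute the input variable $s$ for $N$ in the compiled term. The resulting term, whose only leaf symbol is $s$, is defined and equal to the source formula for every integer $s\ge m^v$ (with $m=2$ for $F_T$), and thus in particular for every valid state, i.e. every $s=c_m(w)$ with $\operatorname{len}(w)\ge v$.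
   Context: $\mathbb{N}=\{0,1,2,\ldots\}$. Principal values: for $z\in\mathbb{C}\setminus\{0\}$, $\operatorname{Log} z=\log|z|+i\operatorname{Arg} z$ with $\operatorname{Arg} z\in(-\pi,\pi]$. For $x\neq 0$, $x^y:=e^{y\operatorname{Log}x}$; for $a,b\ne0$ with $b\neq1$, $\log_b a:=\operatorname{Log}a/\operatorname{Log}b$. A term over $\{x^y,\log_b a\}$ is a finite term built from these two binary operations and leaf symbols; it denotes a partial function, undefined where any subterm asks for an excluded logarithm or base. For real $u$, $J(u):=u-\frac12+\frac{\operatorname{Log}(e^{2\pi i(1/2-u)})}{2\pi i}$. A tag system $T=(v,\Sigma,P)$ has an integer deletion number $v\ge2$, a finite alphabet $\Sigma=\{0,\ldots,m-1\}$ with $m\ge2$, and a production map $P:\Sigma\to\Sigma^*$. For $w=w_1\cdots w_n\in\Sigma^*$, $\operatorname{len}(w)=n$ and $c_m(w):=m^n+\sum_{r=1}^n w_r m^{r-1}$. Source formulas and their domains: (1) $J(u)$, for real $u$. (2) For a binary tag system $T=(v,\{0,1\},P)$ with $\alpha=c_2(P(0))$, $\beta=c_2(P(1))$: $F_T(s):=J(s/2^v)+2^{J(\log_2 s)-v}\bigl((s-2J(s/2))(\beta-\alpha)+\alpha-1\bigr)$, for integers $s\ge2^v$. (3) For a general tag system $T=(v,\Sigma,P)$: $F_{T,m}(s):=J(s/m^v)+m^{J(\log_m s)-v}\bigl(L_T(s-mJ(s/m))-1\bigr)$, for integers $s\ge m^v$, where $L_T$ is the rational Lagrange interpolation polynomial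 with $L_T(a)=c_m(P(a))$ for $0\le a<m$ (written in Horner form). (4) $A(x,y)=x+y$, $\delta(y):=J\!\left(\frac{3}{2(y+1)}\right)$, $q(y):=y+\delta(y)$, and $R(x,y):=x-y\,J(x/q(y))$, for $x,y\in\mathbb{N}$. (5) For binary words $P_0,\ldots,P_{k-1}$ ($k\ge1$), with $L$ the rational Lagrange interpolation polynomial satisfying $L(j)=c_2(P_j)$ for $0\le j<k$ (in Horner form), and $j(S):=S-kJ(S/k)$, $s(S):=(S-j(S))/k$, $d(S):=s(S)-2J(s(S)/2)$: the formula $$\Phi(S):=k\left[J\!\left(\tfrac{s(S)}2\right)+2^{J(\log_2 s(S))-1}d(S)(L(j(S))-1)\right]+j(S)+1-kJ\!\left(\tfrac{j(S)+1}{k}\right),$$ for $S=k\,c_2(w)+j$ with $w$ a nonempty binary word and $0\le j<k$. *)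

theory Defs
  imports "HOL-Analysis.Complex_Transcendental" "HOL-Computational_Algebra.Polynomial"
begin

text \<open>\<^const>\<open>Ln\<close> is the principal logarithm, with imaginary part in $(-\pi,\pi]$.\<close>

definition ppow :: "complex \<Rightarrow> complex \<Rightarrow> complex option" where
  "ppow x y = (if x = 0 then None else Some (exp (y * Ln x)))"

definition plog :: "complex \<Rightarrow> complex \<Rightarrow> complex option" where
  "plog b a = (if a = 0 \<or> b = 0 \<or> b = 1 then None else Some (Ln a / Ln b))"

text \<open>\<open>TPow x y\<close> stands for $x^y$ and \<open>TLog b a\<close> for $\log_b a$.\<close>

datatype (leaves: 'l) ltm = Leaf 'l | TPow "'l ltm" "'l ltm" | TLog "'l ltm" "'l ltm"

primrec eval :: "('l \<Rightarrow> complex) \<Rightarrow> 'l ltm \<Rightarrow> complex option" where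
  "eval \<rho> (Leaf l) = Some (\<rho> l)"
| "eval \<rho> (TPow s t) = Option.bind (eval \<rho> s) (\<lambda>x. Option.bind (eval \<rho> t) (\<lambda>y. ppow x y))"
| "eval \<rho> (TLog s t) = Option.bind (eval \<rho> s) (\<lambda>b. Option.bind (eval \<rho> t) (\<lambda>a. plog b a))"

text \<open>The leaf symbols are \<open>Base\<close>, which stands for $N$, and the input variables.\<close>

datatype leaf = Base | Input nat

type_synonym tm = "leaf ltm"

definition one_tm :: tm where
  "one_tm = TLog (Leaf Base) (Leaf Base)"

definition neg_one_tm :: tm where
  "neg_one_tm = TLog (Leaf Base) (TLog (TPow (Leaf Base) (Leaf Base)) (Leaf Base))"

definition mul_tm :: "tm \<Rightarrow> tm \<Rightarrow> tm" where
  "mul_tm x y = TLog (Leaf Base) (TPow (TPow (Leaf Base) x) y)"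

definition add_tm :: "tm \<Rightarrow> tm \<Rightarrow> tm" where
  "add_tm x y = TLog (Leaf Base) (TLog (Leaf Base)
     (TPow (TPow (Leaf Base) (TPow (Leaf Base) x)) (TPow (Leaf Base) y)))"

definition inverse_tm :: "tm \<Rightarrow> tm" where
  "inverse_tm x = TPow x neg_one_tm"

definition div_tm :: "tm \<Rightarrow> tm \<Rightarrow> tm" where
  "div_tm x y = TLog (Leaf Base) (TPow (TPow (Leaf Base) x) (TPow y neg_one_tm))"

definition sub_tm :: "tm \<Rightarrow> tm \<Rightarrow> tm" where
  "sub_tm x y = add_tm x (mul_tm neg_one_tm y)"

text \<open>A nonzero integer is a sum of copies of $1$ or of $-1$, and $0 = 1 + (-1)$.\<close>

primrec repeat_tm :: "tm \<Rightarrow> nat \<Rightarrow> tm" where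
  "repeat_tm u 0 = u"
| "repeat_tm u (Suc n) = add_tm (repeat_tm u n) u"

definition int_tm :: "int \<Rightarrow> tm" where
  "int_tm k =
     (if k = 0 then add_tm one_tm neg_one_tm
      else if k > 0 then repeat_tm one_tm (nat k - 1)
      else repeat_tm neg_one_tm (nat (- k) - 1))"

definition rat_tm :: "rat \<Rightarrow> tm" where
  "rat_tm q = (let (a, b) = quotient_of q in
     if b = 1 then int_tm a else div_tm (int_tm a) (int_tm b))"

text \<open>The compiled form of $J(u) = u - \frac12 + \frac12 \log_{-1}((-1)^{1-2u})$.\<close>

definition J_tm :: "tm \<Rightarrow> tm" where
  "J_tm u = add_tm (sub_tm u (rat_tm (1/2)))
     (mul_tm (rat_tm (1/2))
       (TLog neg_one_tm (TPow neg_one_tm (sub_tm one_tm (mul_tm (rat_tm 2) u)))))"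

datatype src =
    Var nat
  | Const rat
  | Add src src  (infixl \<open>\<^bold>+\<close> 65)
  | Sub src src  (infixl \<open>\<^bold>-\<close> 65)
  | Mul src src  (infixl \<open>\<^bold>*\<close> 70)
  | Div src src  (infixl \<open>\<^bold>'/\<close> 70)
  | SPow src src
  | SLog src src
  | SJ src

primrec compile :: "src \<Rightarrow> tm" where
  "compile (Var i) = Leaf (Input i)"
| "compile (Const q) = rat_tm q"
| "compile (a \<^bold>+ b) = add_tm (compile a) (compile b)"
| "compile (a \<^bold>- b) = sub_tm (compile a) (compile b)"
| "compile (a \<^bold>* b) = mul_tm (compile a) (compile b)"
| "compile (a \<^bold>/ b) = div_tm (compile a) (compile b)"
| "compile (SPow a b) = TPow (compile a) (compile b)"
| "compile (SLog a b) = TLog (compile a) (compile b)"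
| "compile (SJ a) = J_tm (compile a)"

definition subst_base :: "nat \<Rightarrow> tm \<Rightarrow> tm" where
  "subst_base i = map_ltm (\<lambda>l. case l of Base \<Rightarrow> Input i | Input j \<Rightarrow> Input j)"

text \<open>In \<open>w ! r\<close> positions count from $0$, so \<open>w ! r\<close> is the letter $w_{r+1}$.\<close>

definition code :: "nat \<Rightarrow> nat list \<Rightarrow> nat" where
  "code m w = m ^ length w + (\<Sum>r<length w. w ! r * m ^ r)"

definition word :: "nat \<Rightarrow> nat list \<Rightarrow> bool" where
  "word m w \<longleftrightarrow> set w \<subseteq> {..<m}"

definition tag_system :: "nat \<Rightarrow> nat \<Rightarrow> (nat \<Rightarrow> nat list) \<Rightarrow> bool" where
  "tag_system v m P \<longleftrightarrow> v \<ge> 2 \<and> m \<ge> 2 \<and> (\<forall>a<m. word m (P a))"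

definition lagrange :: "nat \<Rightarrow> (nat \<Rightarrow> rat) \<Rightarrow> rat poly" where
  "lagrange n f = (\<Sum>a<n. smult (f a)
     (\<Prod>b\<in>{..<n} - {a}. smult (1 / (of_nat a - of_nat b)) [:- of_nat b, 1:]))"

lemma poly_lagrange:
  assumes "a < n"
  shows "poly (lagrange n f) (of_nat a) = f a"
proof -
  have z: "(\<Prod>b\<in>{..<n} - {c}. (1 / (of_nat c - of_nat b)) * (of_nat a - of_nat b)) =
      (if c = a then 1 else (0::rat))" if "c < n" for c
  proof (cases "c = a")
    case True
    then show ?thesis by (auto intro!: prod.neutral)
  next
    case False
    then have "a \<in> {..<n} - {c}" using assms by auto
    then have "\<exists>b\<in>{..<n} - {c}. (1 / (of_nat c - of_nat b)) * (of_nat a - of_nat b) = (0::rat)"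
      by (intro bexI[of _ a]) auto
    then show ?thesis using False by (simp only: prod_zero finite_Diff finite_lessThan if_False)
  qed
  have "poly (lagrange n f) (of_nat a) = (\<Sum>c<n. f c *
      (\<Prod>b\<in>{..<n} - {c}. (1 / (of_nat c - of_nat b)) * (of_nat a - of_nat b)))"
    by (simp add: lagrange_def poly_sum poly_prod diff_divide_distrib)
  also have "\<dots> = (\<Sum>c<n. if c = a then f c else 0)"
    using assms by (intro sum.cong) (auto simp: z)
  finally show ?thesis using assms by (simp add: sum.delta)
qed

lemma degree_lagrange:
  assumes "n > 0"
  shows "degree (lagrange n f) < n"
proof -
  have "degree (\<Prod>b\<in>{..<n} - {a}. smult (1 / (of_nat a - of_nat b)) [:- of_nat b, 1::rat:]) \<le> n - 1"
    if "a < n" for a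
  proof -
    have "degree (\<Prod>b\<in>{..<n} - {a}. smult (1 / (of_nat a - of_nat b)) [:- of_nat b, 1::rat:])
       \<le> (\<Sum>b\<in>{..<n} - {a}. degree (smult (1 / (of_nat a - of_nat b)) [:- of_nat b, 1::rat:]))"
      using degree_prod_sum_le[of "{..<n} - {a}"
        "\<lambda>b. smult (1 / (of_nat a - of_nat b)) [:- of_nat b, 1::rat:]"] by (simp add: o_def)
    also have "\<dots> \<le> (\<Sum>b\<in>{..<n} - {a}. 1)"
      by (rule sum_mono) simp
    finally show ?thesis using that by simp
  qed
  then have "degree (lagrange n f) \<le> n - 1"
    unfolding lagrange_def
    by (intro degree_sum_le) (auto intro: order_trans[OF degree_smult_le])
  then show ?thesis using assms by simp
qed

definition J :: "complex \<Rightarrow> complex" where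
  "J u = u - 1/2 + Ln (exp (2 * of_real pi * \<i> * (1/2 - u))) / (2 * of_real pi * \<i>)"

definition F2 :: "nat \<Rightarrow> (nat \<Rightarrow> nat list) \<Rightarrow> complex \<Rightarrow> complex" where
  "F2 v P s = (let \<alpha> = of_nat (code 2 (P 0)); \<beta> = of_nat (code 2 (P 1)) in
     J (s / 2^v) + 2 powr (J (Ln s / Ln 2) - of_nat v) * ((s - 2 * J (s/2)) * (\<beta> - \<alpha>) + \<alpha> - 1))"

definition L_tag :: "nat \<Rightarrow> (nat \<Rightarrow> nat list) \<Rightarrow> rat poly" where
  "L_tag m P = lagrange m (\<lambda>a. of_nat (code m (P a)))"

definition Fm :: "nat \<Rightarrow> nat \<Rightarrow> (nat \<Rightarrow> nat list) \<Rightarrow> complex \<Rightarrow> complex" where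
  "Fm v m P s = J (s / of_nat m ^ v) + of_nat m powr (J (Ln s / Ln (of_nat m)) - of_nat v) *
     (poly (map_poly of_rat (L_tag m P)) (s - of_nat m * J (s / of_nat m)) - 1)"

definition A_fun :: "complex \<Rightarrow> complex \<Rightarrow> complex" where
  "A_fun x y = x + y"

definition \<delta>_fun :: "complex \<Rightarrow> complex" where
  "\<delta>_fun y = J (3 / (2 * (y + 1)))"

definition q_fun :: "complex \<Rightarrow> complex" where
  "q_fun y = y + \<delta>_fun y"

definition R_fun :: "complex \<Rightarrow> complex \<Rightarrow> complex" where
  "R_fun x y = x - y * J (x / q_fun y)"

definition L_cyc :: "nat \<Rightarrow> (nat \<Rightarrow> nat list) \<Rightarrow> rat poly" where
  "L_cyc k P = lagrange k (\<lambda>j. of_nat (code 2 (P j)))"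

definition \<Phi> :: "nat \<Rightarrow> (nat \<Rightarrow> nat list) \<Rightarrow> complex \<Rightarrow> complex" where
  "\<Phi> k P S = (let j = S - of_nat k * J (S / of_nat k);
       s = (S - j) / of_nat k;
       d = s - 2 * J (s/2) in
     of_nat k * (J (s/2) + 2 powr (J (Ln s / Ln 2) - 1) * d *
         (poly (map_poly of_rat (L_cyc k P)) j - 1))
       + j + 1 - of_nat k * J ((j + 1) / of_nat k))"

fun horner :: "rat list \<Rightarrow> src \<Rightarrow> src" where
  "horner [] x = Const 0"
| "horner [c] x = Const c"
| "horner (c # c' # cs) x = Const c \<^bold>+ x \<^bold>* horner (c' # cs) x"

definition F2_src :: "nat \<Rightarrow> (nat \<Rightarrow> nat list) \<Rightarrow> src \<Rightarrow> src" where
  "F2_src v P s = (let \<alpha> = Const (of_nat (code 2 (P 0))); \<beta> = Const (of_nat (code 2 (P 1))) in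
     SJ (s \<^bold>/ Const (2^v)) \<^bold>+ SPow (Const 2) (SJ (SLog (Const 2) s) \<^bold>- Const (of_nat v)) \<^bold>*
       ((s \<^bold>- Const 2 \<^bold>* SJ (s \<^bold>/ Const 2)) \<^bold>* (\<beta> \<^bold>- \<alpha>) \<^bold>+ \<alpha> \<^bold>- Const 1))"

definition Fm_src :: "nat \<Rightarrow> nat \<Rightarrow> (nat \<Rightarrow> nat list) \<Rightarrow> src \<Rightarrow> src" where
  "Fm_src v m P s = (let m' = Const (of_nat m) in
     SJ (s \<^bold>/ Const (of_nat m ^ v)) \<^bold>+ SPow m' (SJ (SLog m' s) \<^bold>- Const (of_nat v)) \<^bold>*
       (horner (coeffs (L_tag m P)) (s \<^bold>- m' \<^bold>* SJ (s \<^bold>/ m')) \<^bold>- Const 1))"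

definition A_src :: "src \<Rightarrow> src \<Rightarrow> src" where
  "A_src x y = x \<^bold>+ y"

definition \<delta>_src :: "src \<Rightarrow> src" where
  "\<delta>_src y = SJ (Const 3 \<^bold>/ (Const 2 \<^bold>* (y \<^bold>+ Const 1)))"

definition q_src :: "src \<Rightarrow> src" where
  "q_src y = y \<^bold>+ \<delta>_src y"

definition R_src :: "src \<Rightarrow> src \<Rightarrow> src" where
  "R_src x y = x \<^bold>- y \<^bold>* SJ (x \<^bold>/ q_src y)"

definition \<Phi>_src :: "nat \<Rightarrow> (nat \<Rightarrow> nat list) \<Rightarrow> src \<Rightarrow> src" where
  "\<Phi>_src k P S = (let k' = Const (of_nat k);
       j = S \<^bold>- k' \<^bold>* SJ (S \<^bold>/ k');
       s = (S \<^bold>- j) \<^bold>/ k';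
       d = s \<^bold>- Const 2 \<^bold>* SJ (s \<^bold>/ Const 2) in
     k' \<^bold>* (SJ (s \<^bold>/ Const 2) \<^bold>+ SPow (Const 2) (SJ (SLog (Const 2) s) \<^bold>- Const 1) \<^bold>* d \<^bold>*
         (horner (coeffs (L_cyc k P)) j \<^bold>- Const 1))
       \<^bold>+ j \<^bold>+ Const 1 \<^bold>- k' \<^bold>* SJ ((j \<^bold>+ Const 1) \<^bold>/ k'))"

text \<open>The value of a source expression, used only in the lemmas below, which confirm that each
  expression denotes its formula. Here \<open>/\<close> and \<^const>\<open>Ln\<close> are total; where the compiled terms
  are defined is a matter of \<^const>\<open>eval\<close>.\<close>

primrec den :: "(nat \<Rightarrow> complex) \<Rightarrow> src \<Rightarrow> complex" where
  "den \<sigma> (Var i) = \<sigma> i"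
| "den \<sigma> (Const c) = of_rat c"
| "den \<sigma> (a \<^bold>+ b) = den \<sigma> a + den \<sigma> b"
| "den \<sigma> (a \<^bold>- b) = den \<sigma> a - den \<sigma> b"
| "den \<sigma> (a \<^bold>* b) = den \<sigma> a * den \<sigma> b"
| "den \<sigma> (a \<^bold>/ b) = den \<sigma> a / den \<sigma> b"
| "den \<sigma> (SPow a b) = den \<sigma> a powr den \<sigma> b"
| "den \<sigma> (SLog a b) = Ln (den \<sigma> b) / Ln (den \<sigma> a)"
| "den \<sigma> (SJ a) = J (den \<sigma> a)"

lemma den_horner: "den \<sigma> (horner (coeffs p) x) = poly (map_poly of_rat p) (den \<sigma> x)"
proof -
  have "den \<sigma> (horner cs x) = foldr (\<lambda>c y. of_rat c + den \<sigma> x * y) cs 0" for cs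
    by (induction cs x rule: horner.induct) simp_all
  moreover have "poly (map_poly of_rat p) z = foldr (\<lambda>c y. of_rat c + z * y) (coeffs p) 0"
    for z :: complex
    by (induction p) (auto simp: map_poly_pCons cCons_def)
  ultimately show ?thesis by simp
qed

lemma den_F2: "den \<sigma> (F2_src v P s) = F2 v P (den \<sigma> s)"
  by (simp add: F2_src_def F2_def Let_def of_rat_power)

lemma den_Fm: "den \<sigma> (Fm_src v m P s) = Fm v m P (den \<sigma> s)"
  by (simp add: Fm_src_def Fm_def Let_def of_rat_power den_horner)

lemma den_A: "den \<sigma> (A_src x y) = A_fun (den \<sigma> x) (den \<sigma> y)"
  by (simp add: A_src_def A_fun_def)

lemma den_R: "den \<sigma> (R_src x y) = R_fun (den \<sigma> x) (den \<sigma> y)"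
  by (simp add: R_src_def R_fun_def q_src_def q_fun_def \<delta>_src_def \<delta>_fun_def)

lemma den_\<Phi>: "den \<sigma> (\<Phi>_src k P S) = \<Phi> k P (den \<sigma> S)"
  by (simp add: \<Phi>_src_def \<Phi>_def Let_def den_horner)

end

theory Submission
  imports Defs
begin

text \<open>
  With a real base $N > 1$, the map $x \mapsto N^x$ carries addition to multiplication, and raising
  to a power carries multiplication into the exponent: $(N^x)^y = N^{xy}$. Hence one logarithm undoes
  a double power into a product, and a second logarithm turns that product into a sum. Over the
  complex numbers these laws fail in general because of the branches of the logarithm. They do
  hold here because every power that is formed has a positive real base, where \<^const>\<open>Ln\<close> is the
  real logarithm. There are two exceptions: the reciprocal $x^{-1} = e^{-\operatorname{Log} x}$, which
  is right for every nonzero $x$ on any branch, and the power of $-1$ inside \<^const>\<open>J\<close>, where the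
  jump of the principal branch is what is wanted: it makes $J(u) = \lfloor u \rfloor$ for real $u$.

  The terms for the arithmetic operations and for \<^const>\<open>J\<close> therefore turn real values into real
  values. Following the structure of a source expression, the lemmas \<open>computes_intros\<close> show
  that its compiled term is defined, with the same real value as the expression, as soon as each
  divisor is nonzero, each power has a positive base, and each logarithm has a positive argument and
  a positive base other than 1. In the source formulas the bases are constants and most divisors
  are too. What is left to check is that $s > 0$ in $\log_m s$, that $q(y) > 0$, and that the state
  $s(S)$ in $\Phi$ is $c_2(w) > 0$; the last two use $J = \lfloor\cdot\rfloor$.

  Nothing depends on which $N > 1$ is chosen, and $s \ge m^v > 1$, so the input $s$
  itself can serve as the base (lemma \<open>eval_subst_base\<close>).
\<close>

section \<open>Powers and logarithms with real arguments\<close>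

lemma ppow_of_real:
  assumes "x > 0"
  shows "ppow (of_real x) (of_real y) = Some (of_real (x powr y))"
  using assms by (simp add: ppow_def Ln_of_real powr_def flip: exp_of_real)

lemma plog_of_real:
  assumes "b > 0" "b \<noteq> 1" "a > 0"
  shows "plog (of_real b) (of_real a) = Some (of_real (log b a))"
  using assms by (simp add: plog_def Ln_of_real log_def)

lemma ppow_minus_one:
  assumes "x \<noteq> 0"
  shows "ppow (of_real x) (-1) = Some (of_real (inverse x))"
  using assms by (simp add: ppow_def exp_minus)

text \<open>Since $\operatorname{Log}(-1) = \pi i$, the power $(-1)^{1-2u}$ is the same exponential
  $e^{2\pi i(1/2-u)}$ that occurs in \<^const>\<open>J\<close>, and dividing by $\operatorname{Log}(-1)$ instead of
  $2\pi i$ costs the factor $\frac12$.\<close>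

lemma J_eq_log_minus_one:
  "\<exists>p l. ppow (-1) (1 - 2 * u) = Some p \<and> plog (-1) p = Some l \<and> J u = u - 1/2 + 1/2 * l"
proof -
  have "exp ((1 - 2 * u) * Ln (-1)) = exp (2 * of_real pi * \<i> * (1/2 - u))"
    by (simp add: algebra_simps)
  moreover have "(-1::complex) \<noteq> 1" by simp
  ultimately show ?thesis
    by (simp add: ppow_def plog_def J_def)
qed

text \<open>$J(u) - u + \frac12$ is the representative modulo 1 of $\frac12 - u$ in
  $(-\frac12, \frac12]$. So $J(u)$ is an integer, and it lies in $(u - 1, u]$.\<close>

lemma J_of_real: "J (of_real u) = of_real (of_int \<lfloor>u\<rfloor>)"
proof -
  define t where "t = 1/2 - u + of_int \<lfloor>u\<rfloor>"
  have t: "-1/2 < t" "t \<le> 1/2"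
    unfolding t_def by linarith+
  have "2 * of_real pi * \<i> * (1/2 - of_real u) =
      2 * of_real pi * \<i> * of_real t - 2 * of_int \<lfloor>u\<rfloor> * of_real pi * \<i>"
    by (simp add: t_def algebra_simps)
  then have "exp (2 * of_real pi * \<i> * (1/2 - of_real u)) = exp (2 * of_real pi * \<i> * of_real t)"
    using exp_integer_2pi[of "of_int \<lfloor>u\<rfloor>"] by (simp add: exp_diff)
  moreover have "Ln (exp (2 * of_real pi * \<i> * of_real t)) = 2 * of_real pi * \<i> * of_real t"
  proof (rule Ln_exp)
    have "pi * (-1) < pi * (2 * t)" "pi * (2 * t) \<le> pi * 1"
      using t by (intro mult_strict_left_mono mult_left_mono; simp)+
    then show "- pi < Im (2 * of_real pi * \<i> * of_real t)"
      "Im (2 * of_real pi * \<i> * of_real t) \<le> pi" by (simp_all add: mult_ac)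
  qed
  ultimately have "J (of_real u) = of_real u - 1/2 + of_real t"
    by (simp add: J_def)
  then show ?thesis
    by (simp add: t_def)
qed

section \<open>Arithmetic over a real base\<close>

locale real_base =
  fixes \<rho> :: "leaf \<Rightarrow> complex" and N :: real
  assumes Base: "\<rho> Base = of_real N" and gt_1: "N > 1"
begin

lemma eval_one_tm: "eval \<rho> one_tm = Some 1"
  using gt_1 plog_of_real[of N N] by (simp add: one_tm_def Base)

text \<open>$\log_{N^N} N = 1/N$, whose logarithm to the base $N$ is $-1$.\<close>

lemma eval_neg_one_tm: "eval \<rho> neg_one_tm = Some (-1)"
proof -
  have "N powr N \<noteq> 1"
    using gt_1 by (simp add: powr_eq_one_iff_gen)
  moreover have "log (N powr N) N = N powr (-1)"
    using gt_1 by (simp add: log_def ln_powr powr_minus_divide)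
  moreover have "log N (N powr (-1)) = -1"
    using gt_1 by (simp only: log_powr_cancel)
  ultimately show ?thesis
    using gt_1 plog_of_real[of N "N powr (-1)"]
    by (simp add: neg_one_tm_def Base ppow_of_real plog_of_real del: powr_neg_one)
qed

lemma eval_mul_tm:
  assumes "eval \<rho> s = Some (of_real x)" "eval \<rho> t = Some (of_real y)"
  shows "eval \<rho> (mul_tm s t) = Some (of_real (x * y))"
  using assms gt_1
  by (simp add: mul_tm_def Base ppow_of_real plog_of_real powr_powr del: of_real_mult)

lemma eval_add_tm:
  assumes "eval \<rho> s = Some (of_real x)" "eval \<rho> t = Some (of_real y)"
  shows "eval \<rho> (add_tm s t) = Some (of_real (x + y))"
  using assms gt_1
  by (simp add: add_tm_def Base ppow_of_real plog_of_real powr_powr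
      del: of_real_add flip: powr_add)

lemma eval_inverse_tm:
  assumes "eval \<rho> s = Some (of_real x)" "x \<noteq> 0"
  shows "eval \<rho> (inverse_tm s) = Some (of_real (inverse x))"
  using assms by (simp add: inverse_tm_def eval_neg_one_tm ppow_minus_one del: of_real_inverse)

lemma eval_div_tm:
  assumes "eval \<rho> s = Some (of_real x)" "eval \<rho> t = Some (of_real y)" "y \<noteq> 0"
  shows "eval \<rho> (div_tm s t) = Some (of_real (x / y))"
  using eval_mul_tm[OF assms(1) eval_inverse_tm[OF assms(2,3)]]
  by (simp add: mul_tm_def div_tm_def inverse_tm_def divide_inverse)

lemma eval_sub_tm:
  assumes "eval \<rho> s = Some (of_real x)" "eval \<rho> t = Some (of_real y)"
  shows "eval \<rho> (sub_tm s t) = Some (of_real (x - y))"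
  using eval_add_tm[OF assms(1) eval_mul_tm[of neg_one_tm "-1", OF _ assms(2)]]
  by (simp add: sub_tm_def eval_neg_one_tm)

lemma eval_repeat_tm:
  assumes "eval \<rho> t = Some (of_real x)"
  shows "eval \<rho> (repeat_tm t n) = Some (of_real (of_nat (Suc n) * x))"
proof (induction n)
  case 0
  then show ?case using assms by simp
next
  case (Suc n)
  have "of_nat (Suc n) * x + x = of_nat (Suc (Suc n)) * x"
    by (simp add: algebra_simps)
  then show ?case using eval_add_tm[OF Suc assms] by simp
qed

lemma eval_int_tm: "eval \<rho> (int_tm k) = Some (of_real (of_int k))"
proof -
  have one: "eval \<rho> one_tm = Some (of_real 1)" and neg: "eval \<rho> neg_one_tm = Some (of_real (-1))"
    by (simp_all add: eval_one_tm eval_neg_one_tm)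
  consider "k = 0" | "k > 0" | "k < 0" by linarith
  then show ?thesis
  proof cases
    case 1
    then show ?thesis using eval_add_tm[OF one neg] by (simp add: int_tm_def)
  next
    case 2
    then show ?thesis using eval_repeat_tm[OF one, of "nat k - 1"] by (simp add: int_tm_def)
  next
    case 3
    then show ?thesis using eval_repeat_tm[OF neg, of "nat (- k) - 1"] by (simp add: int_tm_def)
  qed
qed

lemma eval_rat_tm: "eval \<rho> (rat_tm q) = Some (of_real (of_rat q))"
proof -
  obtain a b where ab: "quotient_of q = (a, b)" by fastforce
  then have b: "b > 0" by (rule quotient_of_denom_pos)
  have q: "real_of_rat q = of_int a / of_int b"
    using quotient_of_div[OF ab] by (simp add: of_rat_divide)
  show ?thesis
    using b eval_div_tm[OF eval_int_tm[of a] eval_int_tm[of b]]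
    by (simp add: rat_tm_def ab q eval_int_tm)
qed

lemma eval_J_tm:
  assumes "eval \<rho> t = Some (of_real u)"
  shows "eval \<rho> (J_tm t) = Some (of_real (of_int \<lfloor>u\<rfloor>))"
proof -
  obtain p l where p: "ppow (-1) (1 - 2 * of_real u) = Some p" and l: "plog (-1) p = Some l"
    and J: "J (of_real u) = of_real u - 1/2 + 1/2 * l"
    using J_eq_log_minus_one by blast
  \<comment> \<open>The logarithm must be known to be real before it can be multiplied by $\frac12$.\<close>
  define r where "r = 2 * (of_int \<lfloor>u\<rfloor> - u + 1/2)"
  have "l = of_real r"
  proof -
    have "l = 2 * (J (of_real u) - of_real u + 1/2)"
      by (simp add: J algebra_simps)
    then show ?thesis by (simp add: J_of_real r_def)
  qed
  moreover have "eval \<rho> (sub_tm one_tm (mul_tm (rat_tm 2) t)) = Some (1 - 2 * of_real u)"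
    using eval_sub_tm[of one_tm 1, OF _ eval_mul_tm[OF eval_rat_tm[of 2] assms]]
    by (simp add: eval_one_tm)
  ultimately have "eval \<rho> (TLog neg_one_tm (TPow neg_one_tm
      (sub_tm one_tm (mul_tm (rat_tm 2) t)))) = Some (of_real r)"
    using p l by (simp add: eval_neg_one_tm)
  from eval_add_tm[OF eval_sub_tm[OF assms eval_rat_tm] eval_mul_tm[OF eval_rat_tm this]]
  have "eval \<rho> (J_tm t) = Some (of_real (u - of_rat (1/2) + of_rat (1/2) * r))"
    unfolding J_tm_def .
  moreover have "u - of_rat (1/2) + of_rat (1/2) * r = of_int \<lfloor>u\<rfloor>"
    by (simp add: r_def of_rat_divide field_simps)
  ultimately show ?thesis by simp
qed

section \<open>Compiled expressions keep their values\<close>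

text \<open>That the common value is a real number is part of the invariant: the arithmetic terms
  are correct for real operands, but not for all complex ones.\<close>

definition computes :: "src \<Rightarrow> real \<Rightarrow> bool" where
  "computes e r \<longleftrightarrow>
     eval \<rho> (compile e) = Some (of_real r) \<and> den (\<lambda>i. \<rho> (Input i)) e = of_real r"

lemma computes_eval:
  assumes "computes e r"
  shows "eval \<rho> (compile e) = Some (den (\<lambda>i. \<rho> (Input i)) e)"
  using assms by (simp add: computes_def)

lemma computes_Var: "\<rho> (Input i) = of_real r \<Longrightarrow> computes (Var i) r"
  by (simp add: computes_def)

lemma computes_Const: "computes (Const q) (of_rat q)"
proof -
  have "complex_of_real (of_rat q) = of_rat q"
    by (cases q) (simp add: of_rat_rat)
  then show ?thesis by (simp add: computes_def eval_rat_tm)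
qed

lemma computes_Add: "computes a r \<Longrightarrow> computes b s \<Longrightarrow> computes (a \<^bold>+ b) (r + s)"
  using eval_add_tm by (simp add: computes_def)

lemma computes_Sub: "computes a r \<Longrightarrow> computes b s \<Longrightarrow> computes (a \<^bold>- b) (r - s)"
  using eval_sub_tm by (simp add: computes_def)

lemma computes_Mul: "computes a r \<Longrightarrow> computes b s \<Longrightarrow> computes (a \<^bold>* b) (r * s)"
  using eval_mul_tm by (simp add: computes_def)

lemma computes_Div: "computes a r \<Longrightarrow> computes b s \<Longrightarrow> s \<noteq> 0 \<Longrightarrow> computes (a \<^bold>/ b) (r / s)"
  using eval_div_tm by (simp add: computes_def)

lemma computes_SPow:
  "computes a r \<Longrightarrow> computes b s \<Longrightarrow> r > 0 \<Longrightarrow> computes (SPow a b) (r powr s)"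
  by (simp add: computes_def ppow_of_real powr_of_real)

lemma computes_SLog:
  "computes a r \<Longrightarrow> computes b s \<Longrightarrow> r > 0 \<Longrightarrow> r \<noteq> 1 \<Longrightarrow> s > 0 \<Longrightarrow> computes (SLog a b) (log r s)"
  by (simp add: computes_def plog_of_real Ln_of_real log_def)

lemma computes_SJ: "computes a r \<Longrightarrow> computes (SJ a) (of_int \<lfloor>r\<rfloor>)"
  using eval_J_tm by (simp add: computes_def J_of_real)

lemma computes_horner:
  "computes x r \<Longrightarrow> computes (horner cs x) (foldr (\<lambda>c y. of_rat c + r * y) cs 0)"
proof (induction cs x rule: horner.induct)
  case (1 x)
  then show ?case using computes_Const[of 0] by simp
next
  case (2 c x)
  then show ?case using computes_Const[of c] by simp
next
  case (3 c c' cs x)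
  show ?case
    using computes_Add[OF computes_Const computes_Mul[OF 3(2) 3(1)[OF 3(2)]]] by simp
qed

lemmas computes_intros = computes_Const computes_Add computes_Sub computes_Mul computes_Div
  computes_SPow computes_SLog computes_SJ computes_horner

section \<open>The source formulas on their domains\<close>

lemma eval_F2:
  assumes "\<rho> (Input 0) = of_nat s" "s > 0"
  shows "eval \<rho> (compile (F2_src v P (Var 0))) = Some (F2 v P (of_nat s))"
proof -
  have s: "computes (Var 0) (real s)"
    using assms by (intro computes_Var) simp
  have "\<exists>r. computes (F2_src v P (Var 0)) r"
    unfolding F2_src_def Let_def
    by (rule exI, (rule computes_intros s | (use assms in \<open>simp add: of_rat_power\<close>))+)
  then show ?thesis
    using assms by (auto dest!: computes_eval simp: den_F2)
qed

lemma eval_Fm: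
  assumes "\<rho> (Input 0) = of_nat s" "s > 0" "m \<ge> 2"
  shows "eval \<rho> (compile (Fm_src v m P (Var 0))) = Some (Fm v m P (of_nat s))"
proof -
  have s: "computes (Var 0) (real s)"
    using assms by (intro computes_Var) simp
  have "\<exists>r. computes (Fm_src v m P (Var 0)) r"
    unfolding Fm_src_def Let_def
    by (rule exI, (rule computes_intros s | (use assms in \<open>simp add: of_rat_power\<close>))+)
  then show ?thesis
    using assms by (auto dest!: computes_eval simp: den_Fm)
qed

lemma computes_\<delta>:
  assumes "computes e (real y)"
  shows "computes (\<delta>_src e) (of_int \<lfloor>3 / (2 * (real y + 1))\<rfloor>)"
proof -
  have "computes (\<delta>_src e) (of_int \<lfloor>of_rat 3 / (of_rat 2 * (real y + of_rat 1))\<rfloor>)"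
    unfolding \<delta>_src_def by (rule computes_intros assms)+ simp
  then show ?thesis by simp
qed

text \<open>$\delta(0) = \lfloor \frac32 \rfloor = 1$ is what keeps the divisor $q(0)$ away from 0. For
  $y \ge 1$ it is enough that $\delta(y) \ge 0$.\<close>

lemma q_pos: "real y + of_int \<lfloor>3 / (2 * (real y + 1))\<rfloor> > 0"
proof (cases "y = 0")
  case True
  then show ?thesis by simp
next
  case False
  have "of_int \<lfloor>3 / (2 * (real y + 1))\<rfloor> \<ge> (0::real)" by simp
  then show ?thesis using False by linarith
qed

lemma eval_arith:
  assumes x: "\<rho> (Input 0) = of_nat x" and y: "\<rho> (Input 1) = of_nat y"
  shows "eval \<rho> (compile (A_src (Var 0) (Var 1))) = Some (A_fun (of_nat x) (of_nat y))"
    and "eval \<rho> (compile (\<delta>_src (Var 1))) = Some (\<delta>_fun (of_nat y))"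
    and "eval \<rho> (compile (q_src (Var 1))) = Some (q_fun (of_nat y))"
    and "eval \<rho> (compile (R_src (Var 0) (Var 1))) = Some (R_fun (of_nat x) (of_nat y))"
proof -
  have vx: "computes (Var 0) (real x)" and vy: "computes (Var 1) (real y)"
    using x y by (auto intro!: computes_Var)
  note \<delta> = computes_\<delta>[OF vy]
  have q: "computes (q_src (Var 1)) (real y + of_int \<lfloor>3 / (2 * (real y + 1))\<rfloor>)"
    unfolding q_src_def by (intro computes_Add vy \<delta>)
  have A: "computes (A_src (Var 0) (Var 1)) (real x + real y)"
    unfolding A_src_def by (intro computes_Add vx vy)
  have "\<exists>r. computes (R_src (Var 0) (Var 1)) r"
    unfolding R_src_def
    by (rule exI, (rule computes_Sub computes_Mul computes_SJ computes_Div vx vy q)+)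
      (use q_pos[of y] in simp)
  then show "eval \<rho> (compile (R_src (Var 0) (Var 1))) = Some (R_fun (of_nat x) (of_nat y))"
    using x y by (auto dest!: computes_eval simp: den_R)
  show "eval \<rho> (compile (A_src (Var 0) (Var 1))) = Some (A_fun (of_nat x) (of_nat y))"
    using computes_eval[OF A] x y by (simp add: den_A)
  show "eval \<rho> (compile (\<delta>_src (Var 1))) = Some (\<delta>_fun (of_nat y))"
    using computes_eval[OF \<delta>] y by (simp add: \<delta>_src_def \<delta>_fun_def)
  show "eval \<rho> (compile (q_src (Var 1))) = Some (q_fun (of_nat y))"
    using computes_eval[OF q] y by (simp add: q_src_def q_fun_def \<delta>_src_def \<delta>_fun_def)
qed

text \<open>As $j < k$, the quotient $\lfloor S/k \rfloor$ is $c$, and this is also the argument $s(S)$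
  of the logarithm in $\Phi$.\<close>

lemma eval_\<Phi>:
  assumes S: "\<rho> (Input 0) = of_nat (k * c + j)" and "j < k" "c > 0"
  shows "eval \<rho> (compile (\<Phi>_src k P (Var 0))) = Some (\<Phi> k P (of_nat (k * c + j)))"
proof -
  define S' where "S' = real (k * c + j)"
  have vS: "computes (Var 0) S'"
    using S by (intro computes_Var) (simp add: S'_def)
  have k: "real k > 0" using assms by simp
  have "\<lfloor>S' / real k\<rfloor> = int c"
    unfolding S'_def floor_divide_of_nat_eq using assms by simp
  then have s: "(S' - (S' - of_rat (of_nat k) * of_int \<lfloor>S' / of_rat (of_nat k)\<rfloor>)) /
      of_rat (of_nat k) > 0"
    using assms by simp
  have "\<exists>r. computes (\<Phi>_src k P (Var 0)) r"
    unfolding \<Phi>_src_def Let_def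
    by (rule exI, (rule computes_intros vS s | (use k in simp))+)
  then show ?thesis
    using S by (auto dest!: computes_eval simp: den_\<Phi>)
qed

end

section \<open>Leaves and substitution\<close>

lemma leaves_add_tm [simp]: "leaves (add_tm s t) = insert Base (leaves s \<union> leaves t)"
  and leaves_mul_tm [simp]: "leaves (mul_tm s t) = insert Base (leaves s \<union> leaves t)"
  and leaves_one_tm [simp]: "leaves one_tm = {Base}"
  and leaves_neg_one_tm [simp]: "leaves neg_one_tm = {Base}"
  by (auto simp: add_tm_def mul_tm_def one_tm_def neg_one_tm_def)

lemma leaves_sub_tm [simp]: "leaves (sub_tm s t) = insert Base (leaves s \<union> leaves t)"
  and leaves_div_tm [simp]: "leaves (div_tm s t) = insert Base (leaves s \<union> leaves t)"
  by (auto simp: sub_tm_def div_tm_def)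

lemma leaves_rat_tm [simp]: "leaves (rat_tm q) = {Base}"
proof -
  have "leaves (repeat_tm t n) = {Base}" if "leaves t = {Base}" for t n
    using that by (induction n) auto
  then have "leaves (int_tm k) = {Base}" for k
    by (auto simp: int_tm_def)
  then show ?thesis by (simp add: rat_tm_def split: prod.split)
qed

lemma leaves_J_tm [simp]: "leaves (J_tm t) = insert Base (leaves t)"
  by (auto simp: J_tm_def)

text \<open>A constant interpolation polynomial is compiled without its argument; this happens for
  instance when all words \<open>P a\<close> have the same code.\<close>

lemma leaves_horner [simp]:
  "leaves (compile (horner cs x)) =
     (if length cs \<le> 1 then {Base} else insert Base (leaves (compile x)))"
  by (induction cs x rule: horner.induct) auto

lemma leaves_F2: "leaves (compile (F2_src v P (Var 0))) = {Base, Input 0}"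
  by (auto simp: F2_src_def Let_def)

lemma leaves_Fm: "leaves (compile (Fm_src v m P (Var 0))) = {Base, Input 0}"
  by (auto simp: Fm_src_def Let_def)

lemma leaves_\<Phi>: "leaves (compile (\<Phi>_src k P (Var 0))) = {Base, Input 0}"
  by (auto simp: \<Phi>_src_def Let_def)

lemma leaves_subst_base: "leaves (subst_base i t) = (\<lambda>l. if l = Base then Input i else l) ` leaves t"
  unfolding subst_base_def ltm.set_map by (intro image_cong) (auto split: leaf.split)

lemma eval_subst_base: "eval \<rho> (subst_base i t) = eval (\<rho>(Base := \<rho> (Input i))) t"
proof (induction t)
  case (Leaf l)
  then show ?case by (cases l) (simp_all add: subst_base_def)
qed (simp_all add: subst_base_def)

section \<open>The input as the base\<close>

lemma code_ge_power: "length w \<ge> v \<Longrightarrow> m \<ge> 1 \<Longrightarrow> code m w \<ge> m ^ v"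
  unfolding code_def by (meson power_increasing trans_le_add1)

lemma real_base_subst:
  assumes "tag_system v m P" "s \<ge> m ^ v" "\<rho> (Input 0) = of_nat s"
  shows "real_base (\<rho>(Base := \<rho> (Input 0))) (real s)"
proof -
  have "1 < m ^ v"
    using assms(1) by (intro one_less_power) (auto simp: tag_system_def)
  then show ?thesis
    using assms by (simp add: real_base_def)
qed

lemma eval_subst_F2:
  assumes "tag_system v 2 P" "s \<ge> 2 ^ v" "\<rho> (Input 0) = of_nat s"
  shows "eval \<rho> (subst_base 0 (compile (F2_src v P (Var 0)))) = Some (F2 v P (of_nat s))"
proof -
  interpret real_base "\<rho>(Base := \<rho> (Input 0))" "real s"
    using assms by (rule real_base_subst)
  show ?thesis
    unfolding eval_subst_base using assms(3) gt_1 by (intro eval_F2) auto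
qed

lemma eval_subst_Fm:
  assumes "tag_system v m P" "s \<ge> m ^ v" "\<rho> (Input 0) = of_nat s"
  shows "eval \<rho> (subst_base 0 (compile (Fm_src v m P (Var 0)))) = Some (Fm v m P (of_nat s))"
proof -
  interpret real_base "\<rho>(Base := \<rho> (Input 0))" "real s"
    using assms by (rule real_base_subst)
  show ?thesis
    unfolding eval_subst_base using assms gt_1 by (intro eval_Fm) (auto simp: tag_system_def)
qed

theorem lemma6p1:
  fixes N :: real
  assumes "N > 1"
  shows
    \<comment> \<open>constants\<close>
    "(\<forall>\<rho>. \<rho> Base = of_real N \<longrightarrow> eval \<rho> one_tm = Some 1 \<and> eval \<rho> neg_one_tm = Some (-1))
    \<and>
    \<comment> \<open>arithmetic identities\<close>
    (\<forall>\<rho> (x::real) (y::real).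
       \<rho> Base = of_real N \<and> \<rho> (Input 0) = of_real x \<and> \<rho> (Input 1) = of_real y \<longrightarrow>
         eval \<rho> (mul_tm (Leaf (Input 0)) (Leaf (Input 1))) = Some (of_real (x * y))
       \<and> eval \<rho> (add_tm (Leaf (Input 0)) (Leaf (Input 1))) = Some (of_real (x + y))
       \<and> (x \<noteq> 0 \<longrightarrow> eval \<rho> (inverse_tm (Leaf (Input 0))) = Some (of_real (inverse x)))
       \<and> (y \<noteq> 0 \<longrightarrow> eval \<rho> (div_tm (Leaf (Input 0)) (Leaf (Input 1))) = Some (of_real (x / y))))
    \<and>
    \<comment> \<open>the identity for J\<close>
    (\<forall>u::real. \<exists>p l. ppow (-1) (1 - 2 * of_real u) = Some p \<and> plog (-1) p = Some l \<and>
       J (of_real u) = of_real u - 1/2 + 1/2 * l)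
    \<and>
    \<comment> \<open>compilation of the source formulas: J\<close>
    (leaves (compile (SJ (Var 0))) = {Base, Input 0} \<and>
     (\<forall>\<rho> (u::real). \<rho> Base = of_real N \<and> \<rho> (Input 0) = of_real u \<longrightarrow>
        eval \<rho> (compile (SJ (Var 0))) = Some (J (of_real u))))
    \<and>
    \<comment> \<open>binary tag systems\<close>
    (\<forall>v P. tag_system v 2 P \<longrightarrow>
       leaves (compile (F2_src v P (Var 0))) = {Base, Input 0} \<and>
       (\<forall>\<rho> (s::nat). s \<ge> 2 ^ v \<and> \<rho> Base = of_real N \<and> \<rho> (Input 0) = of_nat s \<longrightarrow>
          eval \<rho> (compile (F2_src v P (Var 0))) = Some (F2 v P (of_nat s))))
    \<and>
    \<comment> \<open>general tag systems\<close>
    (\<forall>v m P. tag_system v m P \<longrightarrow>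
       leaves (compile (Fm_src v m P (Var 0))) = {Base, Input 0} \<and>
       (\<forall>\<rho> (s::nat). s \<ge> m ^ v \<and> \<rho> Base = of_real N \<and> \<rho> (Input 0) = of_nat s \<longrightarrow>
          eval \<rho> (compile (Fm_src v m P (Var 0))) = Some (Fm v m P (of_nat s))))
    \<and>
    \<comment> \<open>addition, the correction \<open>\<delta>\<close>, the denominator \<open>q\<close> and remainder\<close>
    (leaves (compile (A_src (Var 0) (Var 1))) = {Base, Input 0, Input 1} \<and>
     leaves (compile (\<delta>_src (Var 1))) = {Base, Input 1} \<and>
     leaves (compile (q_src (Var 1))) = {Base, Input 1} \<and>
     leaves (compile (R_src (Var 0) (Var 1))) = {Base, Input 0, Input 1} \<and>
     (\<forall>\<rho> (x::nat) (y::nat).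
        \<rho> Base = of_real N \<and> \<rho> (Input 0) = of_nat x \<and> \<rho> (Input 1) = of_nat y \<longrightarrow>
          eval \<rho> (compile (A_src (Var 0) (Var 1))) = Some (A_fun (of_nat x) (of_nat y))
        \<and> eval \<rho> (compile (\<delta>_src (Var 1))) = Some (\<delta>_fun (of_nat y))
        \<and> eval \<rho> (compile (q_src (Var 1))) = Some (q_fun (of_nat y))
        \<and> eval \<rho> (compile (R_src (Var 0) (Var 1))) = Some (R_fun (of_nat x) (of_nat y))))
    \<and>
    \<comment> \<open>the formula \<open>\<Phi>\<close>\<close>
    (\<forall>k P. k \<ge> 1 \<and> (\<forall>j<k. word 2 (P j)) \<longrightarrow>
       leaves (compile (\<Phi>_src k P (Var 0))) = {Base, Input 0} \<and>
       (\<forall>\<rho> w j. w \<noteq> [] \<and> word 2 w \<and> j < k \<and>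
          \<rho> Base = of_real N \<and> \<rho> (Input 0) = of_nat (k * code 2 w + j) \<longrightarrow>
          eval \<rho> (compile (\<Phi>_src k P (Var 0))) = Some (\<Phi> k P (of_nat (k * code 2 w + j)))))
    \<and>
    \<comment> \<open>no constants needed for tag systems: the input substituted for N\<close>
    (\<forall>v P. tag_system v 2 P \<longrightarrow>
       leaves (subst_base 0 (compile (F2_src v P (Var 0)))) = {Input 0} \<and>
       (\<forall>\<rho> (s::nat). s \<ge> 2 ^ v \<and> \<rho> (Input 0) = of_nat s \<longrightarrow>
          eval \<rho> (subst_base 0 (compile (F2_src v P (Var 0)))) = Some (F2 v P (of_nat s))) \<and>
       (\<forall>\<rho> w. word 2 w \<and> length w \<ge> v \<and> \<rho> (Input 0) = of_nat (code 2 w) \<longrightarrow>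
          eval \<rho> (subst_base 0 (compile (F2_src v P (Var 0)))) = Some (F2 v P (of_nat (code 2 w)))))
    \<and>
    (\<forall>v m P. tag_system v m P \<longrightarrow>
       leaves (subst_base 0 (compile (Fm_src v m P (Var 0)))) = {Input 0} \<and>
       (\<forall>\<rho> (s::nat). s \<ge> m ^ v \<and> \<rho> (Input 0) = of_nat s \<longrightarrow>
          eval \<rho> (subst_base 0 (compile (Fm_src v m P (Var 0)))) = Some (Fm v m P (of_nat s))) \<and>
       (\<forall>\<rho> w. word m w \<and> length w \<ge> v \<and> \<rho> (Input 0) = of_nat (code m w) \<longrightarrow>
          eval \<rho> (subst_base 0 (compile (Fm_src v m P (Var 0)))) = Some (Fm v m P (of_nat (code m w)))))"
proof (intro conjI allI impI; (elim conjE)?)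
  fix \<rho> :: "leaf \<Rightarrow> complex"
  assume b: "\<rho> Base = of_real N"
  then interpret real_base \<rho> N using assms by unfold_locales
  show "eval \<rho> one_tm = Some 1" "eval \<rho> neg_one_tm = Some (-1)"
    by (rule eval_one_tm eval_neg_one_tm)+
next
  fix \<rho> :: "leaf \<Rightarrow> complex" and x y :: real
  assume b: "\<rho> Base = of_real N" and x: "\<rho> (Input 0) = of_real x" and y: "\<rho> (Input 1) = of_real y"
  from b interpret real_base \<rho> N using assms by unfold_locales
  have l: "eval \<rho> (Leaf (Input 0)) = Some (of_real x)" "eval \<rho> (Leaf (Input 1)) = Some (of_real y)"
    using x y by simp_all
  show "eval \<rho> (mul_tm (Leaf (Input 0)) (Leaf (Input 1))) = Some (of_real (x * y))"
    "eval \<rho> (add_tm (Leaf (Input 0)) (Leaf (Input 1))) = Some (of_real (x + y))"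
    using l by (rule eval_mul_tm eval_add_tm)+
  show "eval \<rho> (inverse_tm (Leaf (Input 0))) = Some (of_real (inverse x))" if "x \<noteq> 0"
    using l(1) that by (rule eval_inverse_tm)
  show "eval \<rho> (div_tm (Leaf (Input 0)) (Leaf (Input 1))) = Some (of_real (x / y))" if "y \<noteq> 0"
    using l that by (rule eval_div_tm)
next
  fix u :: real
  show "\<exists>p l. ppow (-1) (1 - 2 * of_real u) = Some p \<and> plog (-1) p = Some l \<and>
      J (of_real u) = of_real u - 1/2 + 1/2 * l"
    by (rule J_eq_log_minus_one)
next
  fix \<rho> :: "leaf \<Rightarrow> complex" and u :: real
  assume b: "\<rho> Base = of_real N" and u: "\<rho> (Input 0) = of_real u"
  from b interpret real_base \<rho> N using assms by unfold_locales
  show "eval \<rho> (compile (SJ (Var 0))) = Some (J (of_real u))"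
    using computes_eval[OF computes_SJ[OF computes_Var[OF u]]] u by simp
next
  fix v P and \<rho> :: "leaf \<Rightarrow> complex" and s :: nat
  assume "tag_system v 2 P" and s: "2 ^ v \<le> s" "\<rho> (Input 0) = of_nat s"
    and b: "\<rho> Base = of_real N"
  from b interpret real_base \<rho> N using assms by unfold_locales
  have "s > 0" using s(1) by (intro Nat.gr0I) simp
  with s(2) show "eval \<rho> (compile (F2_src v P (Var 0))) = Some (F2 v P (of_nat s))"
    by (rule eval_F2)
next
  fix v m P and \<rho> :: "leaf \<Rightarrow> complex" and s :: nat
  assume t: "tag_system v m P" and s: "m ^ v \<le> s" "\<rho> (Input 0) = of_nat s"
    and b: "\<rho> Base = of_real N"
  from b interpret real_base \<rho> N using assms by unfold_locales
  have m: "m \<ge> 2" using t by (simp add: tag_system_def)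
  then have "s > 0" using s(1) by (intro Nat.gr0I) simp
  with s(2) show "eval \<rho> (compile (Fm_src v m P (Var 0))) = Some (Fm v m P (of_nat s))"
    using m by (rule eval_Fm)
next
  fix \<rho> :: "leaf \<Rightarrow> complex" and x y :: nat
  assume b: "\<rho> Base = of_real N" and xy: "\<rho> (Input 0) = of_nat x" "\<rho> (Input 1) = of_nat y"
  from b interpret real_base \<rho> N using assms by unfold_locales
  show "eval \<rho> (compile (A_src (Var 0) (Var 1))) = Some (A_fun (of_nat x) (of_nat y))"
    "eval \<rho> (compile (\<delta>_src (Var 1))) = Some (\<delta>_fun (of_nat y))"
    "eval \<rho> (compile (q_src (Var 1))) = Some (q_fun (of_nat y))"
    "eval \<rho> (compile (R_src (Var 0) (Var 1))) = Some (R_fun (of_nat x) (of_nat y))"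
    using xy by (rule eval_arith)+
next
  fix k P w and \<rho> :: "leaf \<Rightarrow> complex" and j :: nat
  assume j: "j < k" and b: "\<rho> Base = of_real N"
    and S: "\<rho> (Input 0) = of_nat (k * code 2 w + j)"
  from b interpret real_base \<rho> N using assms by unfold_locales
  have "code 2 w > 0" by (simp add: code_def)
  with S j show "eval \<rho> (compile (\<Phi>_src k P (Var 0))) = Some (\<Phi> k P (of_nat (k * code 2 w + j)))"
    by (rule eval_\<Phi>)
next
  fix v P w and \<rho> :: "leaf \<Rightarrow> complex"
  assume "tag_system v 2 P" "v \<le> length w" "\<rho> (Input 0) = of_nat (code 2 w)"
  then show "eval \<rho> (subst_base 0 (compile (F2_src v P (Var 0)))) = Some (F2 v P (of_nat (code 2 w)))"
    by (intro eval_subst_F2 code_ge_power) auto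
next
  fix v m P w and \<rho> :: "leaf \<Rightarrow> complex"
  assume t: "tag_system v m P" "v \<le> length w" "\<rho> (Input 0) = of_nat (code m w)"
  then show "eval \<rho> (subst_base 0 (compile (Fm_src v m P (Var 0)))) =
      Some (Fm v m P (of_nat (code m w)))"
    by (intro eval_subst_Fm code_ge_power) (auto simp: tag_system_def)
qed (auto simp: leaves_F2 leaves_Fm leaves_\<Phi> leaves_subst_base A_src_def \<delta>_src_def q_src_def
    R_src_def intro: eval_subst_F2 eval_subst_Fm)

end
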